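(* Let $G$ be a finite simple directed graph with at least one edge. The metric 2-step nilpotent Lie algebra $\mathfrak{n}_G$ is Heisenberg-like if and only if one of the following holds (ignoring edge directions): (1) $G$ is a star graph $K_{1,n}$ for some $n\ge 1$; (2) $G$ is the complete graph $K_3$; (3) $G$ is the disjoint union of a connected graph as in (1) or (2) together with $m$ isolated vertices for some $m\in\mathbb{N}$.
   Context: Construction of $\mathfrak{n}_G$: let $G=(S,E)$ be a finite simple directed graph with at least one edge, with vertex set $S=\{X_1,\dots,X_m\}$ and edge set $E=\{Z_1,\dots,Z_q\}$ (at most one edge between two distinct vertices, no loops). Let $\mathcal V$ be the real vector space with basis $S$, $\mathfrak z$ the real vector space with basis $E$, and $\mathfrak n_G=\mathcal V\oplus\mathfrak z$. The Lie bracket is the bilinear skew-symmetric extension of: $[X_i,X_l]=Z_k$ if $Z_k$ is a directed edge from $X_i$ to $X_l$; $[X_i,X_l]=0$ if $X_i,X_l$ are not adjacent; and $[\mathfrak n_G,\mathfrak z]=0$. The inner product is the one making $S\cup E$ orthonormal. For $Z\in\mathfrak z$, the skew-symmetric linear map $j(Z):\mathcal V\to\mathcal V$ is defined by $\langle j(Z)X,Y\rangle=\langle[X,Y],Z\rangle$ for $X,Y\in\mathcal V$. Throughout $\mathfrak z$ and $\mathcal V$ denote these spans of edges and of vertices (also when $G$ has isolated vertices). Heisenberg-like: $\mathfrak n_G$ is Heisenberg-like if there are a fixed integer $m$ and constants $c_1,\dots,c_m\ge 0$ such that for every nonzero $Z\in\mathfrak z$ the distinct eigenvalues of $j(Z)$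 are $\pm i\vartheta_1(Z),\dots,\pm i\vartheta_m(Z)$ with $\vartheta_k(Z)=c_k|Z|$ for $k=1,\dots,m$. $K_{1,n}$ is the complete bipartite graph with parts of sizes $1$ and $n$; $K_3$ is the complete graph on three vertices. *)

theory Defs
  imports "HOL-Analysis.Analysis" "Graph_Theory.Kuratowski"
begin

section \<open>Graphs\<close>

definition simple_directed_graph :: "'v pair_pre_digraph \<Rightarrow> bool" where
  "simple_directed_graph G \<longleftrightarrow> pair_digraph G \<and> asym (parcs G)"

text \<open>An undirected graph is encoded, as in the Graph Theory library, by a symmetric digraph.\<close>

definition underlying_graph :: "'v pair_pre_digraph \<Rightarrow> ('v, 'v \<times> 'v) pre_digraph" where
  "underlying_graph G = with_proj (mk_symmetric (with_proj G))"

definition add_isolated_vertices :: "'v pair_pre_digraph \<Rightarrow> 'v set \<Rightarrow> 'v pair_pre_digraph" where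
  "add_isolated_vertices H I = \<lparr>pverts = pverts H \<union> I, parcs = parcs H\<rparr>"


section \<open>The metric 2-step nilpotent Lie algebra of a directed graph\<close>

text \<open>
  The algebra of \<open>G\<close> is the subspace \<open>nilp_algebra G\<close> of the ambient Euclidean space below. The
  vertices and edges of \<open>G\<close> are orthonormal in the library's inner product. The ambient space is in
  general larger, so \<open>j_map\<close> and its eigenvalues are taken on \<open>vertex_space G\<close> only.
\<close>

type_synonym 'v nilp = "(real ^ 'v) \<times> (real ^ ('v \<times> 'v))"

definition vertex_vec :: "'v::finite \<Rightarrow> 'v nilp" where
  "vertex_vec v = (axis v 1, 0)"

definition edge_vec :: "'v::finite \<times> 'v \<Rightarrow> 'v nilp" where
  "edge_vec e = (0, axis e 1)"

definition vertex_space :: "'v::finite pair_pre_digraph \<Rightarrow> 'v nilp set" where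
  "vertex_space G = span (vertex_vec ` pverts G)"

definition edge_space :: "'v::finite pair_pre_digraph \<Rightarrow> 'v nilp set" where
  "edge_space G = span (edge_vec ` parcs G)"

definition nilp_algebra :: "'v::finite pair_pre_digraph \<Rightarrow> 'v nilp set" where
  "nilp_algebra G = span (vertex_vec ` pverts G \<union> edge_vec ` parcs G)"

definition basis_bracket :: "'v::finite pair_pre_digraph \<Rightarrow> 'v \<Rightarrow> 'v \<Rightarrow> 'v nilp" where
  "basis_bracket G u v =
     (if (u, v) \<in> parcs G then edge_vec (u, v)
      else if (v, u) \<in> parcs G then - edge_vec (v, u)
      else 0)"

definition bracket :: "'v::finite pair_pre_digraph \<Rightarrow> 'v nilp \<Rightarrow> 'v nilp \<Rightarrow> 'v nilp" where
  "bracket G X Y =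
     (\<Sum>u\<in>pverts G. \<Sum>v\<in>pverts G.
        ((X \<bullet> vertex_vec u) * (Y \<bullet> vertex_vec v)) *\<^sub>R basis_bracket G u v)"

definition j_map :: "'v::finite pair_pre_digraph \<Rightarrow> 'v nilp \<Rightarrow> 'v nilp \<Rightarrow> 'v nilp" where
  "j_map G Z X =
     (THE W. W \<in> vertex_space G \<and> (\<forall>Y\<in>vertex_space G. W \<bullet> Y = bracket G X Y \<bullet> Z))"

text \<open>
  Complex eigenvalues of a real endomorphism \<open>f\<close> of the subspace \<open>V\<close>: an eigenvector is a nonzero
  \<open>x + \<i>y\<close> in the complexification of \<open>V\<close>, and the two equations are the real and imaginary parts
  of \<open>f x + \<i> f y = \<mu> (x + \<i>y)\<close>.
\<close>

definition eigenvalues_on :: "'a::real_vector set \<Rightarrow> ('a \<Rightarrow> 'a) \<Rightarrow> complex set" where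
  "eigenvalues_on V f =
     {\<mu>. \<exists>x\<in>V. \<exists>y\<in>V. (x \<noteq> 0 \<or> y \<noteq> 0) \<and>
          f x = Re \<mu> *\<^sub>R x - Im \<mu> *\<^sub>R y \<and>
          f y = Im \<mu> *\<^sub>R x + Re \<mu> *\<^sub>R y}"

text \<open>
  The injectivity of \<open>c\<close> says that the values listed are the distinct eigenvalues; a value
  \<open>c k = 0\<close> contributes the single eigenvalue \<open>0\<close>.
\<close>

definition heisenberg_like :: "'v::finite pair_pre_digraph \<Rightarrow> bool" where
  "heisenberg_like G \<longleftrightarrow>
     (\<exists>(m::nat) (c :: nat \<Rightarrow> real). (\<forall>k\<in>{1..m}. 0 \<le> c k) \<and> inj_on c {1..m} \<and>
        (\<forall>Z\<in>edge_space G. Z \<noteq> 0 \<longrightarrow>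
           eigenvalues_on (vertex_space G) (j_map G Z) =
             (\<Union>k\<in>{1..m}. {\<i> * of_real (c k * norm Z), - (\<i> * of_real (c k * norm Z))})))"


section \<open>Well-definedness\<close>

lemma vertex_vec_inner [simp]: "vertex_vec u \<bullet> vertex_vec v = (if u = v then 1 else 0)"
  by (simp add: vertex_vec_def inner_axis_axis)

lemma vertex_edge_inner [simp]: "vertex_vec u \<bullet> edge_vec e = 0" "edge_vec e \<bullet> vertex_vec u = 0"
  by (simp_all add: vertex_vec_def edge_vec_def)

lemma edge_vec_inner [simp]: "edge_vec e \<bullet> edge_vec e' = (if e = e' then 1 else 0)"
  by (simp add: edge_vec_def inner_axis_axis)

lemma bracket_bilinear: "bilinear (bracket G)"
  unfolding bilinear_def
  by (intro conjI allI linearI)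
     (simp_all add: bracket_def inner_add_left algebra_simps sum.distrib scaleR_sum_right)

lemma bracket_vertex_vec:
  assumes "u \<in> pverts G" "v \<in> pverts G"
  shows "bracket G (vertex_vec u) (vertex_vec v) = basis_bracket G u v"
proof -
  have "(\<Sum>b\<in>pverts G. ((vertex_vec u \<bullet> vertex_vec a) * (vertex_vec v \<bullet> vertex_vec b)) *\<^sub>R basis_bracket G a b)
      = (if u = a then basis_bracket G a v else 0)" for a
  proof -
    have "(\<Sum>b\<in>pverts G. ((vertex_vec u \<bullet> vertex_vec a) * (vertex_vec v \<bullet> vertex_vec b)) *\<^sub>R basis_bracket G a b)
        = (\<Sum>b\<in>pverts G. if v = b then (if u = a then basis_bracket G a b else 0) else 0)"
      by (rule sum.cong) auto
    then show ?thesis using assms by simp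
  qed
  then show ?thesis using assms by (simp add: bracket_def)
qed

lemma bracket_skew:
  assumes "simple_directed_graph G"
  shows "bracket G X Y = - bracket G Y X"
proof -
  have "basis_bracket G u v = - basis_bracket G v u" for u v
    using assms by (auto simp: simple_directed_graph_def basis_bracket_def dest: asymD)
  then have "((X \<bullet> vertex_vec u) * (Y \<bullet> vertex_vec v)) *\<^sub>R basis_bracket G u v
      = - (((Y \<bullet> vertex_vec v) * (X \<bullet> vertex_vec u)) *\<^sub>R basis_bracket G v u)" for u v
    by (metis mult.commute scaleR_minus_right)
  then show ?thesis
    unfolding bracket_def by (subst sum.swap) (simp add: sum_negf)
qed

lemma bracket_in_edge_space: "bracket G X Y \<in> edge_space G"
  unfolding bracket_def edge_space_def basis_bracket_def
  by (intro span_sum span_scale) (auto intro: span_base span_neg span_zero)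

lemma bracket_edge_space:
  assumes "Z \<in> edge_space G"
  shows "bracket G X Z = 0"
proof -
  have "Z \<bullet> vertex_vec v = 0" for v
    using assms unfolding edge_space_def
    by (induction rule: span_induct_alt) (auto simp: inner_add_left)
  then show ?thesis by (simp add: bracket_def)
qed

lemma j_map_ex1:
  "\<exists>!W. W \<in> vertex_space G \<and> (\<forall>Y\<in>vertex_space G. W \<bullet> Y = bracket G X Y \<bullet> Z)"
proof (rule ex_ex1I)
  interpret lin: linear "\<lambda>Y. bracket G X Y"
    using bracket_bilinear unfolding bilinear_def by blast
  define W where "W = (\<Sum>v\<in>pverts G. (bracket G X (vertex_vec v) \<bullet> Z) *\<^sub>R vertex_vec v)"
  have W: "W \<in> vertex_space G"
    unfolding W_def vertex_space_def by (intro span_sum span_scale span_base) auto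
  have *: "W \<bullet> vertex_vec v = bracket G X (vertex_vec v) \<bullet> Z" if "v \<in> pverts G" for v
  proof -
    have "W \<bullet> vertex_vec v
        = (\<Sum>u\<in>pverts G. if u = v then bracket G X (vertex_vec u) \<bullet> Z else 0)"
      unfolding W_def inner_sum_left by (rule sum.cong) auto
    then show ?thesis using that by simp
  qed
  have "W \<bullet> Y = bracket G X Y \<bullet> Z" if "Y \<in> vertex_space G" for Y
    using that unfolding vertex_space_def
    by (induction rule: span_induct_alt)
       (auto simp: inner_add_right inner_add_left lin.add lin.scale lin.zero *)
  with W show "\<exists>W. W \<in> vertex_space G \<and> (\<forall>Y\<in>vertex_space G. W \<bullet> Y = bracket G X Y \<bullet> Z)"
    by blast
next
  fix W W'
  assume W: "W \<in> vertex_space G \<and> (\<forall>Y\<in>vertex_space G. W \<bullet> Y = bracket G X Y \<bullet> Z)"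
    and W': "W' \<in> vertex_space G \<and> (\<forall>Y\<in>vertex_space G. W' \<bullet> Y = bracket G X Y \<bullet> Z)"
  then have "W - W' \<in> vertex_space G"
    unfolding vertex_space_def by (auto intro: span_diff)
  with W W' have "(W - W') \<bullet> (W - W') = 0"
    by (simp add: inner_diff_left)
  then show "W = W'" by simp
qed

lemma j_map:
  shows j_map_in: "j_map G Z X \<in> vertex_space G"
    and j_map_inner: "Y \<in> vertex_space G \<Longrightarrow> j_map G Z X \<bullet> Y = bracket G X Y \<bullet> Z"
  using theI'[OF j_map_ex1[of G X Z]] unfolding j_map_def by blast+

end

theory Submission
  imports Defs
begin

text \<open>
  Both sides are equivalent to the condition that any two edges of \<open>G\<close> have a common vertex.

  The matrix of \<open>j(Z)\<close> in the basis of vertices is, up to transposition, the skew-symmetric matrix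
  \<open>a u v = \<langle>[X\<^sub>u, X\<^sub>v], Z\<rangle>\<close>, whose support consists of edges. If any two edges meet, then \<open>a\<close>
  satisfies the Pluecker relations (\<open>intersecting_pluecker\<close>): for four distinct indices every product
  vanishes, and for repeated indices the relation is an identity. In other words, the two-form
  \<open>\<langle>[\<cdot>,\<cdot>], Z\<rangle>\<close> is decomposable and \<open>j(Z)\<close> has rank two. Contracting the Pluecker relation with \<open>a\<close>
  gives \<open>j(Z)\<^sup>3 = - |Z|\<^sup>2 j(Z)\<close> (\<open>j_map_cube\<close>), so the nonzero eigenvalues are \<open>\<plusminus>\<i>|Z|\<close>
  (\<open>eigenvalues_on_cube\<close>), and the same relation exhibits a kernel vector as soon as there is a
  third vertex (\<open>j_map_kernel\<close>). Hence the constants \<open>1\<close> and, unless there are only two vertices,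
  \<open>0\<close> show that the algebra is Heisenberg-like.

  If instead the edges \<open>e\<close> and \<open>e'\<close> are disjoint, then \<open>\<i>\<close> is an eigenvalue for \<open>Z = e + e'\<close>, whose
  norm is \<open>sqrt 2\<close>. By the scaling law \<open>\<i> / sqrt 2\<close> would be an eigenvalue for \<open>e\<close>, but the
  eigenvalues for a single edge are among \<open>0\<close> and \<open>\<plusminus>\<i>\<close> (\<open>heisenberg_like_imp_intersecting\<close>).

  Finally, pairwise meeting edges either all share one vertex or form a triangle
  (\<open>intersecting_star_or_triangle\<close>).
\<close>

section \<open>Coordinates in the vertex and edge bases\<close>

lemma orthonormal_span_expand:
  fixes b :: "'i \<Rightarrow> 'a::real_inner"
  assumes "finite A" and b: "\<And>i j. b i \<bullet> b j = (if i = j then 1 else 0)"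
    and "x \<in> span (b ` A)"
  shows "x = (\<Sum>i\<in>A. (x \<bullet> b i) *\<^sub>R b i)"
  using assms(3)
proof (induction rule: span_induct_alt)
  case base
  then show ?case by simp
next
  case (step c y z)
  then obtain j where j: "j \<in> A" "y = b j" by blast
  have "(\<Sum>i\<in>A. (b j \<bullet> b i) *\<^sub>R b i) = (\<Sum>i\<in>A. if j = i then b i else 0)"
    by (rule sum.cong) (auto simp: b)
  then have "(\<Sum>i\<in>A. (b j \<bullet> b i) *\<^sub>R b i) = b j"
    using j \<open>finite A\<close> by simp
  then show ?case
    using j step
    by (simp add: inner_add_left scaleR_add_left sum.distrib flip: scaleR_scaleR scaleR_sum_right)
qed

lemma orthonormal_span_norm:
  fixes b :: "'i \<Rightarrow> 'a::real_inner"
  assumes "finite A" and b: "\<And>i j. b i \<bullet> b j = (if i = j then 1 else 0)"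
    and "x \<in> span (b ` A)"
  shows "(norm x)\<^sup>2 = (\<Sum>i\<in>A. (x \<bullet> b i)\<^sup>2)"
proof -
  have "(norm x)\<^sup>2 = x \<bullet> (\<Sum>i\<in>A. (x \<bullet> b i) *\<^sub>R b i)"
    using orthonormal_span_expand[OF assms] by (simp add: power2_norm_eq_inner)
  then show ?thesis
    by (simp add: inner_sum_right power2_eq_square)
qed

lemma vertex_space_expand:
  "X \<in> vertex_space G \<Longrightarrow> X = (\<Sum>v\<in>pverts G. (X \<bullet> vertex_vec v) *\<^sub>R vertex_vec v)"
  unfolding vertex_space_def by (rule orthonormal_span_expand) auto

lemma vertex_space_eqI:
  assumes "X \<in> vertex_space G" "Y \<in> vertex_space G"
    and "\<And>v. v \<in> pverts G \<Longrightarrow> X \<bullet> vertex_vec v = Y \<bullet> vertex_vec v"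
  shows "X = Y"
proof -
  have "(\<Sum>v\<in>pverts G. (X \<bullet> vertex_vec v) *\<^sub>R vertex_vec v)
      = (\<Sum>v\<in>pverts G. (Y \<bullet> vertex_vec v) *\<^sub>R vertex_vec v)"
    using assms(3) by (intro sum.cong) auto
  then show ?thesis
    using vertex_space_expand[OF assms(1)] vertex_space_expand[OF assms(2)] by simp
qed

lemma subspace_vertex_space: "subspace (vertex_space G)"
  by (simp add: vertex_space_def)

lemma vertex_vec_in: "v \<in> pverts G \<Longrightarrow> vertex_vec v \<in> vertex_space G"
  by (simp add: vertex_space_def span_base)

lemma edge_space_coord_outside:
  assumes "Z \<in> edge_space G" "e \<notin> parcs G"
  shows "Z \<bullet> edge_vec e = 0"
  using assms(1) unfolding edge_space_def
proof (induction rule: span_induct_alt)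
  case (step c y z)
  then obtain e' where "e' \<in> parcs G" "y = edge_vec e'" by blast
  with assms(2) have "y \<bullet> edge_vec e = 0" by auto
  with step show ?case by (simp add: inner_add_left)
qed simp

lemma simple_directed_graphD:
  assumes "simple_directed_graph G" "(u, v) \<in> parcs G"
  shows "u \<in> pverts G" "v \<in> pverts G" "u \<noteq> v" "(v, u) \<notin> parcs G"
proof -
  interpret pair_digraph G using assms by (simp add: simple_directed_graph_def)
  show "u \<in> pverts G" "v \<in> pverts G" "u \<noteq> v"
    using assms(2) pair_no_loops[OF assms(2)] by (auto dest: wellformed')
  show "(v, u) \<notin> parcs G"
    using assms by (auto simp: simple_directed_graph_def dest: asymD)
qed


section \<open>The skew-symmetric matrix of the map j\<close>

definition j_coeff :: "'v::finite pair_pre_digraph \<Rightarrow> 'v nilp \<Rightarrow> 'v \<Rightarrow> 'v \<Rightarrow> real" where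
  "j_coeff G Z u v = basis_bracket G u v \<bullet> Z"

lemma j_coeff_skew:
  assumes "simple_directed_graph G"
  shows "j_coeff G Z v u = - j_coeff G Z u v"
  using simple_directed_graphD(4)[OF assms, of u v]
  by (auto simp: j_coeff_def basis_bracket_def)

lemma j_coeff_self:
  assumes "simple_directed_graph G"
  shows "j_coeff G Z u u = 0"
  using j_coeff_skew[OF assms, of Z u u] by simp

lemma j_coeff_eq_0: "(u, v) \<notin> parcs G \<Longrightarrow> (v, u) \<notin> parcs G \<Longrightarrow> j_coeff G Z u v = 0"
  by (simp add: j_coeff_def basis_bracket_def)

lemma j_coeff_edge: "(u, v) \<in> parcs G \<Longrightarrow> j_coeff G Z u v = Z \<bullet> edge_vec (u, v)"
  by (simp add: j_coeff_def basis_bracket_def inner_commute)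

lemma j_coeff_add: "j_coeff G (Y + Z) u v = j_coeff G Y u v + j_coeff G Z u v"
  by (simp add: j_coeff_def inner_add_right)

lemma j_coeff_edge_vec:
  assumes "simple_directed_graph G" "(u, v) \<in> parcs G"
  shows "j_coeff G (edge_vec (u, v)) p q =
    (if p = u \<and> q = v then 1 else if p = v \<and> q = u then - 1 else 0)"
  using simple_directed_graphD(4)[OF assms] assms(2)
  by (auto simp: j_coeff_def basis_bracket_def)

text \<open>
  Every edge is counted in both directions, whence the factor \<open>2\<close>.
\<close>

lemma sum_j_coeff_squares:
  assumes G: "simple_directed_graph G" and Z: "Z \<in> edge_space G"
  shows "(\<Sum>u\<in>pverts G. \<Sum>v\<in>pverts G. (j_coeff G Z u v)\<^sup>2) = 2 * (norm Z)\<^sup>2"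
proof -
  let ?V = "pverts G" and ?z = "\<lambda>u v. (Z \<bullet> edge_vec (u, v))\<^sup>2"
  have sq: "(j_coeff G Z u v)\<^sup>2 = ?z u v + ?z v u" for u v
    using simple_directed_graphD(4)[OF G, of u v] simple_directed_graphD(4)[OF G, of v u]
    by (auto simp: j_coeff_def basis_bracket_def inner_commute edge_space_coord_outside[OF Z])
  have sub: "parcs G \<subseteq> ?V \<times> ?V"
    using simple_directed_graphD[OF G] by auto
  have "(\<Sum>u\<in>?V. \<Sum>v\<in>?V. ?z u v) = (\<Sum>e\<in>?V \<times> ?V. (Z \<bullet> edge_vec e)\<^sup>2)"
    by (simp add: sum.cartesian_product)
  also have "\<dots> = (\<Sum>e\<in>parcs G. (Z \<bullet> edge_vec e)\<^sup>2)"
    using sub by (intro sum.mono_neutral_right) (auto simp: edge_space_coord_outside[OF Z])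
  also have "\<dots> = (norm Z)\<^sup>2"
    using Z unfolding edge_space_def by (intro orthonormal_span_norm[symmetric]) auto
  finally have "(\<Sum>u\<in>?V. \<Sum>v\<in>?V. ?z u v) = (norm Z)\<^sup>2" .
  moreover have "(\<Sum>u\<in>?V. \<Sum>v\<in>?V. ?z v u) = (\<Sum>u\<in>?V. \<Sum>v\<in>?V. ?z u v)"
    by (rule sum.swap)
  ultimately show ?thesis
    by (simp add: sq sum.distrib)
qed

lemma j_coeff_nonzero:
  assumes G: "simple_directed_graph G" and Z: "Z \<in> edge_space G" "Z \<noteq> 0"
  obtains u v where "u \<in> pverts G" "v \<in> pverts G" "j_coeff G Z u v \<noteq> 0"
proof -
  have "(\<Sum>u\<in>pverts G. \<Sum>v\<in>pverts G. (j_coeff G Z u v)\<^sup>2) \<noteq> 0"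
    using sum_j_coeff_squares[OF G Z(1)] Z(2) by simp
  then have "\<exists>u\<in>pverts G. \<exists>v\<in>pverts G. j_coeff G Z u v \<noteq> 0"
    by (metis (no_types, lifting) sum.neutral zero_power2)
  then show ?thesis using that by blast
qed

lemma j_map_coord:
  assumes "v \<in> pverts G"
  shows "j_map G Z X \<bullet> vertex_vec v = (\<Sum>u\<in>pverts G. (X \<bullet> vertex_vec u) * j_coeff G Z u v)"
proof -
  have "j_map G Z X \<bullet> vertex_vec v = bracket G X (vertex_vec v) \<bullet> Z"
    using assms by (intro j_map_inner vertex_vec_in)
  also have "\<dots> = (\<Sum>u\<in>pverts G. \<Sum>w\<in>pverts G.
      if v = w then (X \<bullet> vertex_vec u) * j_coeff G Z u w else 0)"
    unfolding bracket_def inner_sum_left by (intro sum.cong) (auto simp: j_coeff_def)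
  finally show ?thesis using assms by simp
qed

lemma j_map_linear: "linear (j_map G Z)"
proof (rule linearI)
  fix X Y :: "'a nilp" and r :: real
  show "j_map G Z (X + Y) = j_map G Z X + j_map G Z Y"
    by (rule vertex_space_eqI[of _ G])
      (simp_all add: j_map_coord inner_add_left distrib_right sum.distrib j_map_in
        subspace_add[OF subspace_vertex_space])
  show "j_map G Z (r *\<^sub>R X) = r *\<^sub>R j_map G Z X"
    by (rule vertex_space_eqI[of _ G])
      (simp_all add: j_map_coord sum_distrib_left mult.assoc j_map_in
        subspace_scale[OF subspace_vertex_space])
qed

lemma j_map_vertex_vec:
  assumes "u \<in> pverts G" "v \<in> pverts G"
  shows "j_map G Z (vertex_vec u) \<bullet> vertex_vec v = j_coeff G Z u v"
proof -
  have "(\<Sum>w\<in>pverts G. (vertex_vec u \<bullet> vertex_vec w) * j_coeff G Z w v)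
      = (\<Sum>w\<in>pverts G. if u = w then j_coeff G Z w v else 0)"
    by (rule sum.cong) auto
  then show ?thesis using assms by (simp add: j_map_coord)
qed

lemma j_map_nonzero:
  assumes G: "simple_directed_graph G" and Z: "Z \<in> edge_space G" "Z \<noteq> 0"
  obtains X where "X \<in> vertex_space G" "j_map G Z X \<noteq> 0"
proof -
  obtain u v where uv: "u \<in> pverts G" "v \<in> pverts G" "j_coeff G Z u v \<noteq> 0"
    using j_coeff_nonzero[OF assms] .
  then have "j_map G Z (vertex_vec u) \<noteq> 0"
    using j_map_vertex_vec[OF uv(1,2), of Z] by auto
  with uv(1) show ?thesis using that vertex_vec_in by blast
qed


section \<open>The Pluecker relations\<close>

text \<open>
  For a skew-symmetric matrix these are the equations stating that the two-form with matrix \<open>a\<close> is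
  decomposable, that is, of rank at most two.
\<close>

definition pluecker :: "'i set \<Rightarrow> ('i \<Rightarrow> 'i \<Rightarrow> real) \<Rightarrow> bool" where
  "pluecker V a \<longleftrightarrow>
     (\<forall>u\<in>V. \<forall>v\<in>V. \<forall>w\<in>V. \<forall>x\<in>V. a u v * a w x - a u w * a v x + a u x * a v w = 0)"

text \<open>
  In the sum for the cube of \<open>a\<close>, rewriting the product of the two outer factors by the relation
  returns the negative of the same sum, together with the sum of squares times \<open>a\<close>.
\<close>

lemma pluecker_cube:
  fixes a :: "'i \<Rightarrow> 'i \<Rightarrow> real"
  assumes skew: "\<And>u v. a v u = - a u v" and a: "pluecker V a" and "u \<in> V" "x \<in> V"
  shows "2 * (\<Sum>v\<in>V. \<Sum>w\<in>V. a u v * a v w * a w x) = - ((\<Sum>v\<in>V. \<Sum>w\<in>V. (a v w)\<^sup>2) * a u x)"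
proof -
  let ?S = "\<Sum>v\<in>V. \<Sum>w\<in>V. a u v * a v w * a w x"
  have step: "a u v * a v w * a w x = - (a u w * a w v * a v x) - a u x * (a v w)\<^sup>2"
    if "v \<in> V" "w \<in> V" for v w
  proof -
    have *: "a u v * a w x = a u w * a v x - a u x * a v w"
      using a that assms(3,4) unfolding pluecker_def by (simp add: algebra_simps)
    have "a u v * a v w * a w x = a v w * (a u v * a w x)"
      by simp
    also have "\<dots> = - (a u w * a w v * a v x) - a u x * (a v w)\<^sup>2"
      unfolding * skew[of v w] by (simp add: algebra_simps power2_eq_square)
    finally show ?thesis .
  qed
  have "?S = (\<Sum>v\<in>V. \<Sum>w\<in>V. - (a u w * a w v * a v x) - a u x * (a v w)\<^sup>2)"
    by (intro sum.cong refl step)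
  also have "\<dots> = - (\<Sum>v\<in>V. \<Sum>w\<in>V. a u w * a w v * a v x) - a u x * (\<Sum>v\<in>V. \<Sum>w\<in>V. (a v w)\<^sup>2)"
    by (simp add: sum_subtractf sum_negf sum_distrib_left)
  also have "(\<Sum>v\<in>V. \<Sum>w\<in>V. a u w * a w v * a v x) = ?S"
    by (rule sum.swap)
  finally show ?thesis by (simp add: algebra_simps)
qed

lemma j_map_cube:
  assumes G: "simple_directed_graph G" and Z: "Z \<in> edge_space G"
    and pl: "pluecker (pverts G) (j_coeff G Z)"
  shows "j_map G Z (j_map G Z (j_map G Z X)) = - (norm Z)\<^sup>2 *\<^sub>R j_map G Z X"
proof (rule vertex_space_eqI[of _ G])
  show "- (norm Z)\<^sup>2 *\<^sub>R j_map G Z X \<in> vertex_space G"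
    by (intro subspace_scale[OF subspace_vertex_space] j_map_in)
next
  fix x assume x: "x \<in> pverts G"
  let ?V = "pverts G" and ?a = "j_coeff G Z" and ?X = "\<lambda>u. X \<bullet> vertex_vec u"
  have cube: "(\<Sum>v\<in>?V. \<Sum>w\<in>?V. ?a u v * ?a v w * ?a w x) = - (norm Z)\<^sup>2 * ?a u x"
    if "u \<in> ?V" for u
    using pluecker_cube[of ?a ?V u x, OF j_coeff_skew[OF G] pl that x] sum_j_coeff_squares[OF G Z]
    by simp
  have "j_map G Z (j_map G Z (j_map G Z X)) \<bullet> vertex_vec x
      = (\<Sum>w\<in>?V. \<Sum>v\<in>?V. \<Sum>u\<in>?V. ?X u * (?a u v * ?a v w * ?a w x))"
    using x by (simp add: j_map_coord sum_distrib_right mult.assoc)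
  also have "\<dots> = (\<Sum>w\<in>?V. \<Sum>u\<in>?V. \<Sum>v\<in>?V. ?X u * (?a u v * ?a v w * ?a w x))"
    by (intro sum.cong refl sum.swap)
  also have "\<dots> = (\<Sum>u\<in>?V. \<Sum>w\<in>?V. \<Sum>v\<in>?V. ?X u * (?a u v * ?a v w * ?a w x))"
    by (rule sum.swap)
  also have "\<dots> = (\<Sum>u\<in>?V. \<Sum>v\<in>?V. \<Sum>w\<in>?V. ?X u * (?a u v * ?a v w * ?a w x))"
    by (intro sum.cong refl sum.swap)
  also have "\<dots> = (\<Sum>u\<in>?V. ?X u * (- (norm Z)\<^sup>2 * ?a u x))"
    by (intro sum.cong refl) (simp add: cube flip: sum_distrib_left)
  also have "\<dots> = (- (norm Z)\<^sup>2 *\<^sub>R j_map G Z X) \<bullet> vertex_vec x"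
    using x by (simp add: j_map_coord sum_distrib_left mult.assoc mult.left_commute sum_negf)
  finally show "j_map G Z (j_map G Z (j_map G Z X)) \<bullet> vertex_vec x
      = (- (norm Z)\<^sup>2 *\<^sub>R j_map G Z X) \<bullet> vertex_vec x" .
qed (rule j_map_in)

text \<open>
  A nonsingular matrix of rank two has size two. For a third vertex \<open>w\<close> the three entries of \<open>a\<close> on
  \<open>u\<close>, \<open>v\<close>, \<open>w\<close> are the coordinates of a kernel vector, which is again the Pluecker relation.
\<close>

lemma j_map_kernel:
  assumes G: "simple_directed_graph G" and Z: "Z \<in> edge_space G" "Z \<noteq> 0"
    and pl: "pluecker (pverts G) (j_coeff G Z)"
  shows "(\<exists>X\<in>vertex_space G. X \<noteq> 0 \<and> j_map G Z X = 0) \<longleftrightarrow> card (pverts G) \<noteq> 2"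
proof -
  let ?a = "j_coeff G Z"
  obtain u v where uv: "u \<in> pverts G" "v \<in> pverts G" "?a u v \<noteq> 0"
    using j_coeff_nonzero[OF G Z] .
  then have "u \<noteq> v"
    using j_coeff_self[OF G, of Z u] by metis
  show ?thesis
  proof
    assume "\<exists>X\<in>vertex_space G. X \<noteq> 0 \<and> j_map G Z X = 0"
    then obtain X where X: "X \<in> vertex_space G" "X \<noteq> 0" "j_map G Z X = 0" by blast
    show "card (pverts G) \<noteq> 2"
    proof
      assume "card (pverts G) = 2"
      then have V: "pverts G = {u, v}"
        using card_subset_eq[of "pverts G" "{u, v}"] uv(1,2) \<open>u \<noteq> v\<close> by simp
      have "(X \<bullet> vertex_vec u) * ?a u v = 0" "(X \<bullet> vertex_vec v) * ?a v u = 0"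
        using j_map_coord[of v G Z X] j_map_coord[of u G Z X] X(3) V \<open>u \<noteq> v\<close>
        by (simp_all add: j_coeff_self[OF G])
      then have "X \<bullet> vertex_vec u = 0" "X \<bullet> vertex_vec v = 0"
        using uv(3) j_coeff_skew[OF G, of Z v u] by auto
      then have "X = 0"
        using V by (intro vertex_space_eqI[OF X(1)]) (auto simp: subspace_0[OF subspace_vertex_space])
      with X(2) show False by contradiction
    qed
  next
    assume "card (pverts G) \<noteq> 2"
    then have "pverts G \<noteq> {u, v}"
      using \<open>u \<noteq> v\<close> by auto
    then obtain w where w: "w \<in> pverts G" "w \<noteq> u" "w \<noteq> v"
      using uv by blast
    let ?K = "?a v w *\<^sub>R vertex_vec u - ?a u w *\<^sub>R vertex_vec v + ?a u v *\<^sub>R vertex_vec w"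
    interpret lin: linear "j_map G Z" by (rule j_map_linear)
    have "?K \<bullet> vertex_vec w \<noteq> 0"
      using w uv(3) by (simp add: inner_add_left inner_diff_left)
    then have "?K \<noteq> 0" by fastforce
    moreover have "?K \<in> vertex_space G"
      using uv w subspace_vertex_space
      by (intro subspace_add subspace_diff subspace_scale vertex_vec_in)
    moreover have "j_map G Z ?K = 0"
    proof (rule vertex_space_eqI[of _ G])
      show "(0 :: 'a nilp) \<in> vertex_space G"
        by (rule subspace_0[OF subspace_vertex_space])
    next
      fix x assume "x \<in> pverts G"
      then have "j_map G Z ?K \<bullet> vertex_vec x = ?a v w * ?a u x - ?a u w * ?a v x + ?a u v * ?a w x"
        using uv w
        by (simp add: lin.add lin.diff lin.scale inner_add_left inner_diff_left j_map_vertex_vec)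
      also have "\<dots> = 0"
        using pl \<open>x \<in> pverts G\<close> uv w unfolding pluecker_def by (simp add: algebra_simps)
      finally show "j_map G Z ?K \<bullet> vertex_vec x = 0 \<bullet> vertex_vec x"
        by simp
    qed (rule j_map_in)
    ultimately show "\<exists>X\<in>vertex_space G. X \<noteq> 0 \<and> j_map G Z X = 0" by blast
  qed
qed


section \<open>Eigenvalues of a map annihilated by a cubic\<close>

text \<open>
  Applying \<open>f\<close> thrice to a complex eigenvector \<open>x + \<i>y\<close> for \<open>\<mu>\<close> shows that \<open>\<mu>\<^sup>3 + s\<^sup>2 \<mu>\<close> annihilates
  it and hence vanishes. Conversely, on the range of \<open>f\<close> the square of \<open>f\<close> is \<open>- s\<^sup>2\<close>, so
  \<open>x \<mp> (\<i>/s) f x\<close> is an eigenvector for every nonzero \<open>x\<close> in the range.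
\<close>

lemma eigenvalues_on_cube:
  fixes f :: "'a::real_vector \<Rightarrow> 'a"
  assumes lin: "linear f" and V: "subspace V" "\<And>x. x \<in> V \<Longrightarrow> f x \<in> V" and s: "s > 0"
    and cube: "\<And>x. x \<in> V \<Longrightarrow> f (f (f x)) = - s\<^sup>2 *\<^sub>R f x"
    and nz: "w \<in> V" "f w \<noteq> 0"
  shows "eigenvalues_on V f =
    {\<i> * of_real s, - (\<i> * of_real s)} \<union> (if \<exists>x\<in>V. x \<noteq> 0 \<and> f x = 0 then {0} else {})"
proof -
  interpret f: linear f by (rule lin)
  let ?R = "{\<i> * of_real s, - (\<i> * of_real s)}"
  have zero: "0 \<in> eigenvalues_on V f \<longleftrightarrow> (\<exists>x\<in>V. x \<noteq> 0 \<and> f x = 0)"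
    using subspace_0[OF V(1)] f.zero by (auto simp: eigenvalues_on_def)
  have sub: "\<mu> \<in> ?R \<union> {0}" if \<mu>: "\<mu> \<in> eigenvalues_on V f" for \<mu>
  proof -
    obtain x y where xy: "x \<in> V" "y \<in> V" "x \<noteq> 0 \<or> y \<noteq> 0"
      and fx: "f x = Re \<mu> *\<^sub>R x - Im \<mu> *\<^sub>R y" and fy: "f y = Im \<mu> *\<^sub>R x + Re \<mu> *\<^sub>R y"
      using \<mu> unfolding eigenvalues_on_def by blast
    have step: "f (Re z *\<^sub>R x - Im z *\<^sub>R y) = Re (z * \<mu>) *\<^sub>R x - Im (z * \<mu>) *\<^sub>R y"
      "f (Im z *\<^sub>R x + Re z *\<^sub>R y) = Im (z * \<mu>) *\<^sub>R x + Re (z * \<mu>) *\<^sub>R y" for z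
      by (simp_all add: f.add f.diff f.scale fx fy algebra_simps)
    define A where "A = \<mu> * \<mu> * \<mu>"
    define \<nu> where "\<nu> = A + of_real (s\<^sup>2) * \<mu>"
    have f3: "f (f (f x)) = Re A *\<^sub>R x - Im A *\<^sub>R y" "f (f (f y)) = Im A *\<^sub>R x + Re A *\<^sub>R y"
      unfolding fx fy step A_def by (rule refl)+
    have "Re A *\<^sub>R x - Im A *\<^sub>R y + s\<^sup>2 *\<^sub>R f x = 0" "Im A *\<^sub>R x + Re A *\<^sub>R y + s\<^sup>2 *\<^sub>R f y = 0"
      unfolding f3[symmetric] cube[OF xy(1)] cube[OF xy(2)] by simp_all
    then have nu: "Re \<nu> *\<^sub>R x - Im \<nu> *\<^sub>R y = 0" "Im \<nu> *\<^sub>R x + Re \<nu> *\<^sub>R y = 0"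
      unfolding fx fy \<nu>_def by (simp_all add: algebra_simps)
    \<comment> \<open>Multiplication by the conjugate of \<open>\<nu>\<close>.\<close>
    have "((Re \<nu>)\<^sup>2 + (Im \<nu>)\<^sup>2) *\<^sub>R x
        = Re \<nu> *\<^sub>R (Re \<nu> *\<^sub>R x - Im \<nu> *\<^sub>R y) + Im \<nu> *\<^sub>R (Im \<nu> *\<^sub>R x + Re \<nu> *\<^sub>R y)"
      "((Re \<nu>)\<^sup>2 + (Im \<nu>)\<^sup>2) *\<^sub>R y
        = Re \<nu> *\<^sub>R (Im \<nu> *\<^sub>R x + Re \<nu> *\<^sub>R y) - Im \<nu> *\<^sub>R (Re \<nu> *\<^sub>R x - Im \<nu> *\<^sub>R y)"
      by (simp_all add: algebra_simps power2_eq_square)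
    then have "(Re \<nu>)\<^sup>2 + (Im \<nu>)\<^sup>2 = 0"
      using nu xy(3) by auto
    then have "\<nu> = 0"
      by (simp add: complex_eq_0)
    moreover have "\<nu> = \<mu> * (\<mu> - \<i> * of_real s) * (\<mu> + \<i> * of_real s)"
      by (simp add: \<nu>_def A_def algebra_simps power2_eq_square)
    ultimately show ?thesis
      by (auto simp: add_eq_0_iff)
  qed
  define x where "x = f w"
  have x: "x \<in> V" "x \<noteq> 0" "f (f x) = - s\<^sup>2 *\<^sub>R x"
    using nz V(2) cube by (auto simp: x_def)
  have "\<exists>y\<in>V. (x \<noteq> 0 \<or> y \<noteq> 0) \<and> f x = 0 *\<^sub>R x - r *\<^sub>R y \<and> f y = r *\<^sub>R x + 0 *\<^sub>R y"
    if r: "r = s \<or> r = - s" for r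
  proof (intro bexI conjI)
    have "r \<noteq> 0" "s\<^sup>2 / r = r"
      using r s by (auto simp: power2_eq_square)
    then show "f x = 0 *\<^sub>R x - r *\<^sub>R ((- 1 / r) *\<^sub>R f x)"
      "f ((- 1 / r) *\<^sub>R f x) = r *\<^sub>R x + 0 *\<^sub>R ((- 1 / r) *\<^sub>R f x)"
      unfolding f.scale x(3) by simp_all
    show "(- 1 / r) *\<^sub>R f x \<in> V"
      by (intro subspace_scale V x)
  qed (use x in auto)
  from this[of s] this[of "- s"] have "?R \<subseteq> eigenvalues_on V f"
    using x(1) unfolding eigenvalues_on_def by auto
  with sub zero show ?thesis by auto
qed

lemma j_map_eigenvalues:
  assumes G: "simple_directed_graph G" and Z: "Z \<in> edge_space G" "Z \<noteq> 0"
    and pl: "pluecker (pverts G) (j_coeff G Z)"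
  shows "eigenvalues_on (vertex_space G) (j_map G Z) =
    {\<i> * of_real (norm Z), - (\<i> * of_real (norm Z))} \<union> (if card (pverts G) \<noteq> 2 then {0} else {})"
proof -
  obtain X where "X \<in> vertex_space G" "j_map G Z X \<noteq> 0"
    using j_map_nonzero[OF G Z] .
  then show ?thesis
    unfolding j_map_kernel[OF G Z pl, symmetric]
    using Z(2) by (intro eigenvalues_on_cube[OF j_map_linear subspace_vertex_space] j_map_in
        j_map_cube[OF G Z(1) pl]) auto
qed


section \<open>Heisenberg-like means that any two edges meet\<close>

definition intersecting :: "('v \<times> 'v) set \<Rightarrow> bool" where
  "intersecting E \<longleftrightarrow> (\<forall>u v w x. (u, v) \<in> E \<longrightarrow> (w, x) \<in> E \<longrightarrow> {u, v} \<inter> {w, x} \<noteq> {})"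

lemma intersecting_subset: "intersecting E \<Longrightarrow> F \<subseteq> E \<Longrightarrow> intersecting F"
  unfolding intersecting_def by blast

text \<open>
  For distinct indices each of the three products involves two disjoint pairs, one of which is not an
  edge in the support of \<open>Z\<close>; for repeated indices the relation follows from skew-symmetry. The
  hypothesis concerns only the support of \<open>Z\<close>, so that it also covers a single edge of an arbitrary
  graph.
\<close>

lemma intersecting_pluecker:
  assumes G: "simple_directed_graph G" and E: "intersecting {e \<in> parcs G. Z \<bullet> edge_vec e \<noteq> 0}"
  shows "pluecker (pverts G) (j_coeff G Z)"
  unfolding pluecker_def
proof (intro ballI)
  fix u v w x
  let ?a = "j_coeff G Z"
  let ?S = "{e \<in> parcs G. Z \<bullet> edge_vec e \<noteq> 0}"
  have edge: "(p, q) \<in> ?S \<or> (q, p) \<in> ?S" if "?a p q \<noteq> 0" for p q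
    using that j_coeff_edge[of p q G Z] j_coeff_edge[of q p G Z] j_coeff_skew[OF G, of Z p q]
      j_coeff_eq_0[of p q G Z] by (cases "(p, q) \<in> parcs G"; cases "(q, p) \<in> parcs G") simp_all
  have meet: "{p, q} \<inter> {r, t} \<noteq> {}" if "(p, q) \<in> ?S" "(r, t) \<in> ?S" for p q r t
    using that by (rule E[unfolded intersecting_def, rule_format])
  have disj: "?a p q * ?a r t = 0" if "{p, q} \<inter> {r, t} = {}" for p q r t
  proof (rule ccontr)
    assume "?a p q * ?a r t \<noteq> 0"
    then have "(p, q) \<in> ?S \<or> (q, p) \<in> ?S" "(r, t) \<in> ?S \<or> (t, r) \<in> ?S"
      using edge[of p q] edge[of r t] by simp_all
    then show False
      using that
    proof (elim disjE)
      assume "(p, q) \<in> ?S" "(r, t) \<in> ?S"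
      from meet[OF this] that show False by contradiction
    next
      assume "(p, q) \<in> ?S" "(t, r) \<in> ?S"
      from meet[OF this] that show False by (simp add: insert_commute)
    next
      assume "(q, p) \<in> ?S" "(r, t) \<in> ?S"
      from meet[OF this] that show False by (simp add: insert_commute)
    next
      assume "(q, p) \<in> ?S" "(t, r) \<in> ?S"
      from meet[OF this] that show False by (simp add: insert_commute)
    qed
  qed
  show "?a u v * ?a w x - ?a u w * ?a v x + ?a u x * ?a v w = 0"
  proof (cases "distinct [u, v, w, x]")
    case True
    then show ?thesis
      using disj[of u v w x] disj[of u w v x] disj[of u x v w] by auto
  next
    case False
    then consider "u = v" | "u = w" | "u = x" | "v = w" | "v = x" | "w = x" by auto
    then show ?thesis
    proof cases
      case 2
      then show ?thesis
        using j_coeff_skew[OF G, of Z w v] by (simp add: j_coeff_self[OF G])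
    next
      case 3
      then show ?thesis
        using j_coeff_skew[OF G, of Z x v] j_coeff_skew[OF G, of Z x w]
        by (simp add: j_coeff_self[OF G])
    next
      case 5
      then show ?thesis
        using j_coeff_skew[OF G, of Z x w] by (simp add: j_coeff_self[OF G])
    qed (simp_all add: j_coeff_self[OF G])
  qed
qed

lemma intersecting_imp_heisenberg_like:
  assumes G: "simple_directed_graph G" and E: "intersecting (parcs G)"
  shows "heisenberg_like G"
proof -
  \<comment> \<open>The constant \<open>0\<close> is listed exactly when there is a third vertex.\<close>
  define m :: nat where "m = (if card (pverts G) = 2 then 1 else 2)"
  define c :: "nat \<Rightarrow> real" where "c k = (if k = 1 then 1 else 0)" for k
  have m: "{1..m} = (if card (pverts G) = 2 then {1} else {1, 2})"
    by (auto simp: m_def)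
  have "eigenvalues_on (vertex_space G) (j_map G Z) =
      (\<Union>k\<in>{1..m}. {\<i> * of_real (c k * norm Z), - (\<i> * of_real (c k * norm Z))})"
    if "Z \<in> edge_space G" "Z \<noteq> 0" for Z
  proof -
    have "intersecting {e \<in> parcs G. Z \<bullet> edge_vec e \<noteq> 0}"
      using E by (rule intersecting_subset) simp
    note j_map_eigenvalues[OF G that intersecting_pluecker[OF G this]]
    also have "{\<i> * of_real (norm Z), - (\<i> * of_real (norm Z))} \<union> (if card (pverts G) \<noteq> 2 then {0} else {})
        = (\<Union>k\<in>{1..m}. {\<i> * of_real (c k * norm Z), - (\<i> * of_real (c k * norm Z))})"
      unfolding m by (cases "card (pverts G) = 2") (simp_all add: c_def insert_commute)
    finally show ?thesis .
  qed
  moreover have "inj_on c {1..m}" "\<forall>k\<in>{1..m}. 0 \<le> c k"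
    unfolding m by (auto simp: c_def)
  ultimately show ?thesis
    unfolding heisenberg_like_def by blast
qed

text \<open>
  On two disjoint edges with equal weights, \<open>j(Z)\<close> has eigenvalues \<open>\<plusminus>\<i>\<close> although \<open>Z\<close> has norm
  \<open>sqrt 2\<close>; this forces a constant \<open>1 / sqrt 2\<close>, which a single edge rules out.
\<close>

lemma heisenberg_like_imp_intersecting:
  assumes G: "simple_directed_graph G" and H: "heisenberg_like G"
  shows "intersecting (parcs G)"
proof (rule ccontr)
  assume "\<not> intersecting (parcs G)"
  then obtain u v w x where e: "(u, v) \<in> parcs G" "(w, x) \<in> parcs G"
    and disj: "{u, v} \<inter> {w, x} = {}"
    unfolding intersecting_def not_all not_imp not_not by (elim exE conjE) (rule that)
  note uv = simple_directed_graphD[OF G e(1)]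
  obtain m :: nat and c :: "nat \<Rightarrow> real" where c: "\<forall>k\<in>{1..m}. 0 \<le> c k"
    and ev: "\<forall>Z\<in>edge_space G. Z \<noteq> 0 \<longrightarrow> eigenvalues_on (vertex_space G) (j_map G Z) =
      (\<Union>k\<in>{1..m}. {\<i> * of_real (c k * norm Z), - (\<i> * of_real (c k * norm Z))})"
    using H unfolding heisenberg_like_def by (elim exE conjE) (rule that)
  define Y where "Y = edge_vec (u, v)"
  define Z where "Z = edge_vec (u, v) + edge_vec (w, x)"
  have YE: "Y \<in> edge_space G" and ZE: "Z \<in> edge_space G"
    using e unfolding Y_def Z_def edge_space_def by (blast intro: span_add span_base)+
  have nY: "norm Y = 1"
    by (simp add: Y_def norm_eq_sqrt_inner)
  have nZ: "norm Z = sqrt 2"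
    using disj by (auto simp: Z_def norm_eq_sqrt_inner inner_add_left inner_add_right)
  have "Y \<noteq> 0" "Z \<noteq> 0"
    using nY nZ by auto
  have d: "u \<noteq> w" "u \<noteq> x" "v \<noteq> w" "v \<noteq> x"
    using disj by auto
  note coeff = j_coeff_add j_coeff_edge_vec[OF G e(1)] j_coeff_edge_vec[OF G e(2)]
  have au: "j_coeff G Z u y = (if y = v then 1 else 0)" for y
    unfolding Z_def coeff using d uv(3) by simp
  have av: "j_coeff G Z v y = (if y = u then - 1 else 0)" for y
    unfolding Z_def coeff using d uv(3) by simp
  \<comment> \<open>As \<open>w\<close> and \<open>x\<close> differ from \<open>u\<close> and \<open>v\<close>, the map \<open>j(Z)\<close> rotates the plane of \<open>u\<close> and \<open>v\<close>.\<close>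
  have ju: "j_map G Z (vertex_vec u) = vertex_vec v"
    by (rule vertex_space_eqI[of _ G])
      (use uv au in \<open>auto simp: j_map_vertex_vec j_map_in vertex_vec_in\<close>)
  have jv: "j_map G Z (vertex_vec v) = - vertex_vec u"
    by (rule vertex_space_eqI[of _ G])
      (use uv av in \<open>auto simp: j_map_vertex_vec j_map_in vertex_vec_in
        intro!: subspace_neg[OF subspace_vertex_space]\<close>)
  have "vertex_vec u \<noteq> 0"
    using vertex_vec_inner[of u u] by fastforce
  moreover have "- vertex_vec v \<in> vertex_space G"
    using subspace_neg[OF subspace_vertex_space vertex_vec_in[OF uv(2)]] .
  moreover have "j_map G Z (- vertex_vec v) = vertex_vec u"
    using linear_neg[OF j_map_linear, of G Z "vertex_vec v"] jv by simp
  ultimately have "\<i> \<in> eigenvalues_on (vertex_space G) (j_map G Z)"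
    unfolding eigenvalues_on_def
    by (intro CollectI bexI[of _ "vertex_vec u"] bexI[of _ "- vertex_vec v"])
      (simp_all add: ju vertex_vec_in uv)
  then have "\<i> \<in> (\<Union>k\<in>{1..m}. {\<i> * of_real (c k * sqrt 2), - (\<i> * of_real (c k * sqrt 2))})"
    using bspec[OF ev ZE] \<open>Z \<noteq> 0\<close> by (simp only: nZ simp_thms)
  then obtain k where k: "k \<in> {1..m}" and "\<i> \<in> {\<i> * of_real (c k * sqrt 2), - (\<i> * of_real (c k * sqrt 2))}"
    by (rule UN_E)
  then have "c k * sqrt 2 = 1 \<or> c k * sqrt 2 = - 1"
    by (auto simp: complex_eq_iff)
  then have ck: "c k * sqrt 2 = 1"
    using bspec[OF c k] by (smt (verit) mult_nonneg_nonneg real_sqrt_ge_zero)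
  have "\<i> * of_real (c k) \<in> (\<Union>k\<in>{1..m}. {\<i> * of_real (c k * norm Y), - (\<i> * of_real (c k * norm Y))})"
    by (rule UN_I[OF k]) (simp add: nY)
  then have "\<i> * of_real (c k) \<in> eigenvalues_on (vertex_space G) (j_map G Y)"
    using bspec[OF ev YE] \<open>Y \<noteq> 0\<close> by (simp only: simp_thms)
  moreover have "intersecting {e \<in> parcs G. Y \<bullet> edge_vec e \<noteq> 0}"
    by (rule intersecting_subset[of "{(u, v)}"])
      (auto simp: intersecting_def Y_def simp del: split_paired_All split: if_splits)
  note j_map_eigenvalues[OF G YE \<open>Y \<noteq> 0\<close> intersecting_pluecker[OF G this]]
  finally have "\<i> * of_real (c k) \<in> {\<i>, - \<i>, 0}"
    by (auto simp: nY split: if_splits)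
  then have "c k = 1 \<or> c k = - 1 \<or> c k = 0"
    by (auto simp: complex_eq_iff)
  with ck bspec[OF c k] show False by auto
qed


section \<open>Graphs in which any two edges meet\<close>

lemma underlying_graph_pair:
  "underlying_graph G = with_proj \<lparr>pverts = pverts G, parcs = parcs G \<union> (parcs G)\<inverse>\<rparr>"
  unfolding underlying_graph_def mk_symmetric_def by (auto intro!: arg_cong[of _ _ with_proj])

lemma intersecting_common_vertex:
  assumes "\<And>u v. (u, v) \<in> E \<Longrightarrow> u = z \<or> v = z"
  shows "intersecting E"
  unfolding intersecting_def
proof (intro allI impI)
  fix u v w x assume "(u, v) \<in> E" "(w, x) \<in> E"
  then have "z \<in> {u, v} \<inter> {w, x}"
    using assms[of u v] assms[of w x] by auto
  then show "{u, v} \<inter> {w, x} \<noteq> {}" by blast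
qed

lemma star_intersecting:
  assumes "complete_bipartite_digraph 1 n (underlying_graph H)"
  shows "intersecting (parcs H)"
proof -
  obtain U V where "card U = 1" and UV: "parcs H \<union> (parcs H)\<inverse> = U \<times> V \<union> V \<times> U"
    using assms unfolding underlying_graph_pair complete_bipartite_digraph_pair_def by auto
  then obtain z where "U = {z}"
    by (auto simp: card_1_singleton_iff)
  with UV show ?thesis
    by (intro intersecting_common_vertex[of _ z]) blast
qed

lemma triangle_intersecting:
  assumes "complete_digraph 3 (underlying_graph H)"
  shows "intersecting (parcs H)"
proof -
  have V: "card (pverts H) = 3"
    and E: "parcs H \<union> (parcs H)\<inverse> = {(u, v). (u, v) \<in> pverts H \<times> pverts H \<and> u \<noteq> v}"
    using assms unfolding underlying_graph_pair complete_digraph_pair_def by simp_all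
  obtain a b c where "pverts H = {a, b, c}"
    using V by (auto simp: card_3_iff)
  then have *: "u \<in> {a, b, c} \<and> v \<in> {a, b, c} \<and> u \<noteq> v" if "(u, v) \<in> parcs H" for u v
    using E that by blast
  show ?thesis
    unfolding intersecting_def
  proof (intro allI impI)
    fix u v w x assume "(u, v) \<in> parcs H" "(w, x) \<in> parcs H"
    from *[OF this(1)] *[OF this(2)] show "{u, v} \<inter> {w, x} \<noteq> {}" by auto
  qed
qed

text \<open>
  If neither end of an edge \<open>ab\<close> lies on all edges, then some edge avoids \<open>a\<close>, so it is \<open>bc\<close>, and
  some edge avoids \<open>b\<close>, so it is \<open>ac\<close> with the same \<open>c\<close>. An edge that meets these three edges
  has both its ends among \<open>a\<close>, \<open>b\<close>, \<open>c\<close>.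
\<close>

lemma intersecting_star_or_triangle:
  assumes "intersecting E" "\<And>u v. (u, v) \<in> E \<Longrightarrow> u \<noteq> v" "E \<noteq> {}"
  obtains (star) z where "\<forall>(u, v)\<in>E. u = z \<or> v = z"
  | (triangle) a b c where "distinct [a, b, c]"
      "E \<union> E\<inverse> = {(u, v). u \<in> {a, b, c} \<and> v \<in> {a, b, c} \<and> u \<noteq> v}"
proof -
  define A where "A = E \<union> E\<inverse>"
  have sym: "(v, u) \<in> A" if "(u, v) \<in> A" for u v
    using that by (auto simp: A_def)
  have irr: "u \<noteq> v" if "(u, v) \<in> A" for u v
    using that assms(2) by (auto simp: A_def)
  have meet: "u = w \<or> u = x \<or> v = w \<or> v = x" if "(u, v) \<in> A" "(w, x) \<in> A" for u v w x
  proof -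
    have *: "u = w \<or> u = x \<or> v = w \<or> v = x" if "(u, v) \<in> E" "(w, x) \<in> E" for u v w x
      using assms(1)[unfolded intersecting_def, rule_format, OF that] by auto
    from that have "(u, v) \<in> E \<or> (v, u) \<in> E" "(w, x) \<in> E \<or> (x, w) \<in> E"
      by (auto simp: A_def)
    then show ?thesis
      by (elim disjE) (drule (1) *, blast)+
  qed
  obtain a b where ab: "(a, b) \<in> A"
    using assms(3) by (auto simp: A_def)
  show thesis
  proof (cases "(\<forall>(u, v)\<in>E. u = a \<or> v = a) \<or> (\<forall>(u, v)\<in>E. u = b \<or> v = b)")
    case True
    then show thesis using star by blast
  next
    case False
    then obtain p q r t where pq: "(p, q) \<in> A" "p \<noteq> a" "q \<noteq> a"
      and rt: "(r, t) \<in> A" "r \<noteq> b" "t \<noteq> b"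
      by (auto simp: A_def)
    obtain c where bc: "(b, c) \<in> A" "c \<noteq> a"
      using pq meet[OF ab pq(1)] sym by metis
    obtain d where ad: "(a, d) \<in> A" "d \<noteq> b"
      using rt meet[OF ab rt(1)] sym by metis
    have "d = c"
      using meet[OF bc(1) ad(1)] irr[OF ab] bc(2) ad(2) by auto
    with ad have ac: "(a, c) \<in> A" by simp
    have "u \<in> {a, b, c} \<and> v \<in> {a, b, c} \<and> u \<noteq> v" if "(u, v) \<in> A" for u v
      using meet[OF that ab] meet[OF that bc(1)] meet[OF that ac] irr[OF that] irr[OF ab] irr[OF bc(1)]
        irr[OF ac] by auto
    then have "A = {(u, v). u \<in> {a, b, c} \<and> v \<in> {a, b, c} \<and> u \<noteq> v}"
      using ab bc(1) ac sym[OF ab] sym[OF bc(1)] sym[OF ac] by auto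
    moreover have "distinct [a, b, c]"
      using irr[OF ab] irr[OF bc(1)] irr[OF ac] by simp
    ultimately show thesis
      using triangle unfolding A_def by blast
  qed
qed

lemma intersecting_decomposition:
  fixes G :: "'v::finite pair_pre_digraph"
  assumes G: "simple_directed_graph G" and "parcs G \<noteq> {}" and E: "intersecting (parcs G)"
  shows "\<exists>H I. ((\<exists>n\<ge>1. complete_bipartite_digraph 1 n (underlying_graph H))
      \<or> complete_digraph 3 (underlying_graph H))
    \<and> pverts H \<inter> I = {} \<and> G = add_isolated_vertices H I"
proof -
  let ?E = "parcs G" and ?W = "Field (parcs G)"
  define H where "H = \<lparr>pverts = ?W, parcs = ?E\<rparr>"
  have irr: "u \<noteq> v" if "(u, v) \<in> ?E" for u v
    using simple_directed_graphD(3)[OF G that] .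
  have "?W \<subseteq> pverts G"
    using simple_directed_graphD(1,2)[OF G] by (auto simp: Field_def)
  then have "G = add_isolated_vertices H (pverts G - ?W)"
    by (simp add: H_def add_isolated_vertices_def Un_absorb1)
  moreover have "pverts H \<inter> (pverts G - ?W) = {}"
    by (auto simp: H_def)
  moreover have "(\<exists>n\<ge>1. complete_bipartite_digraph 1 n (underlying_graph H))
      \<or> complete_digraph 3 (underlying_graph H)"
  proof (rule intersecting_star_or_triangle[OF E irr \<open>?E \<noteq> {}\<close>])
    fix z assume "\<forall>(u, v)\<in>?E. u = z \<or> v = z"
    then have st: "u = z \<or> v = z" if "(u, v) \<in> ?E" for u v
      using that by blast
    obtain p q where pq: "(p, q) \<in> ?E"
      using \<open>?E \<noteq> {}\<close> by auto
    have zW: "z \<in> ?W"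
      using st[OF pq] FieldI1[OF pq] FieldI2[OF pq] by auto
    have leaf: "(z, y) \<in> ?E \<or> (y, z) \<in> ?E" if "y \<in> ?W" "y \<noteq> z" for y
      using that st unfolding Field_def by blast
    have arcs: "?E \<union> ?E\<inverse> = {z} \<times> (?W - {z}) \<union> (?W - {z}) \<times> {z}"
    proof (intro equalityI subrelI)
      fix u v assume "(u, v) \<in> ?E \<union> ?E\<inverse>"
      then show "(u, v) \<in> {z} \<times> (?W - {z}) \<union> (?W - {z}) \<times> {z}"
        using st[of u v] st[of v u] irr[of u v] irr[of v u] by (auto intro: FieldI1 FieldI2)
    next
      fix u v assume "(u, v) \<in> {z} \<times> (?W - {z}) \<union> (?W - {z}) \<times> {z}"
      then show "(u, v) \<in> ?E \<union> ?E\<inverse>"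
        using leaf[of u] leaf[of v] by auto
    qed
    have verts: "?W = {z} \<union> (?W - {z})"
      using zW by blast
    have "complete_bipartite_digraph 1 (card (?W - {z})) (underlying_graph H)"
      unfolding underlying_graph_pair complete_bipartite_digraph_pair_def H_def
        pair_pre_digraph.simps
      by (intro conjI exI[of _ "{z}"] exI[of _ "?W - {z}"] verts arcs) simp_all
    moreover have "?W - {z} \<noteq> {}"
      using irr[OF pq] FieldI1[OF pq] FieldI2[OF pq] by auto
    then have "card (?W - {z}) \<ge> 1"
      by (simp add: Suc_le_eq card_gt_0_iff)
    ultimately show ?thesis by blast
  next
    fix a b c
    assume triangle: "distinct [a, b, c]"
      "?E \<union> ?E\<inverse> = {(u, v). u \<in> {a, b, c} \<and> v \<in> {a, b, c} \<and> u \<noteq> v}"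
    have "?W = Field (?E \<union> ?E\<inverse>)"
      by (auto simp: Field_def)
    also have "\<dots> = {a, b, c}"
      unfolding triangle(2) using triangle(1) by (auto simp: Field_def)
    finally have "?W = {a, b, c}" .
    then have "complete_digraph 3 (underlying_graph H)"
      using triangle unfolding underlying_graph_pair complete_digraph_pair_def H_def by auto
    then show ?thesis by blast
  qed
  ultimately show ?thesis by blast
qed

theorem corollary4p3:
  fixes G :: "'v::finite pair_pre_digraph"
  assumes "simple_directed_graph G"
    and "parcs G \<noteq> {}"
  shows "heisenberg_like G \<longleftrightarrow>
      (\<exists>n\<ge>1. complete_bipartite_digraph 1 n (underlying_graph G))
    \<or> complete_digraph 3 (underlying_graph G)
    \<or> (\<exists>H I m. ((\<exists>n\<ge>1. complete_bipartite_digraph 1 n (underlying_graph H))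
                \<or> complete_digraph 3 (underlying_graph H))
             \<and> pverts H \<inter> I = {} \<and> card I = m
             \<and> G = add_isolated_vertices H I)"
proof
  assume "heisenberg_like G"
  then have "intersecting (parcs G)"
    by (rule heisenberg_like_imp_intersecting[OF assms(1)])
  from intersecting_decomposition[OF assms this]
  show "(\<exists>n\<ge>1. complete_bipartite_digraph 1 n (underlying_graph G))
    \<or> complete_digraph 3 (underlying_graph G)
    \<or> (\<exists>H I m. ((\<exists>n\<ge>1. complete_bipartite_digraph 1 n (underlying_graph H))
                \<or> complete_digraph 3 (underlying_graph H))
             \<and> pverts H \<inter> I = {} \<and> card I = m
             \<and> G = add_isolated_vertices H I)"
    by blast
next
  assume "(\<exists>n\<ge>1. complete_bipartite_digraph 1 n (underlying_graph G))
    \<or> complete_digraph 3 (underlying_graph G)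
    \<or> (\<exists>H I m. ((\<exists>n\<ge>1. complete_bipartite_digraph 1 n (underlying_graph H))
                \<or> complete_digraph 3 (underlying_graph H))
             \<and> pverts H \<inter> I = {} \<and> card I = m
             \<and> G = add_isolated_vertices H I)"
  then have "intersecting (parcs G)"
    by (auto simp: add_isolated_vertices_def simp del: One_nat_def
        dest: star_intersecting triangle_intersecting)
  then show "heisenberg_like G"
    by (rule intersecting_imp_heisenberg_like[OF assms(1)])
qed

end
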